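(* Let $K\ge2$, $T\ge1$, $v\in(0,1]$, $u>0$ and $\beta\in(0,1)$. For every $\epsilon>0$, the LDP Robust Successive Elimination algorithm (defined in the context), run for $T$ rounds with confidence $\beta$ and parameters $\epsilon,v,u$, is $\epsilon$-locally differentially private.
   Context: Local differential privacy. A randomized map $\mathcal M:\mathcal X\to\mathcal Y$ is $\epsilon$-locally differentially private (LDP) if for all $x,x'\in\mathcal X$ and all measurable $O\subset\mathcal Y$, $\mathbb P[\mathcal M(x)\in O]\le e^\epsilon\,\mathbb P[\mathcal M(x')\in O]$. In a bandit problem with $K$ arms, where in each round the learner pulls an arm and a real reward is generated, a bandit algorithm is $\epsilon$-LDP if each reward is perturbed by an $\epsilon$-LDP map before being collected, and the learner's decisions depend only on past arms, past perturbed rewards and internal randomness. $\mathrm{Lap}(\lambda)$ is the Laplace distribution with density $\frac1{2\lambda}e^{-|x|/\lambda}$. $\log$ is the natural logarithm. LDP Robust Successive Elimination (inputs $\beta,\epsilon,v,u$, horizon $T$). Start with the viable set $\mathcal S=[K]$. For epochs $\tau=1,2,\dots$, until $|\mathcal S|=1$ (the procedure is stopped in any case after $T$ pulls): - Set $L_\tau=\log(8|\mathcal S|\tau^2/\beta)$, $D_\tau=4^{-\tau}$, $R_\tau=\left\lceil u^{2/v}\frac{28^{2(1+v)/v}L_\tau}{\epsilon^2D_\tau^{2(1+v)/v}}+L_\tau\right\rceil$ and $B_\tau=\left(\frac{u\sqrt{R_\tau}\,\epsilon}{\sqrt{L_\tau}}\right)^{1/(1+v)}$. - Pull each $a\in\mathcal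 S$ exactly $R_\tau$ times (cycling through $\mathcal S$), generating fresh rewards $x_{a,1},\dots,x_{a,R_\tau}$. Each reward is truncated to $\widetilde x_{a,r}=x_{a,r}\mathbb I_{\{|x_{a,r}|\le B_\tau\}}$ and released as $\widehat x_{a,r}=\widetilde x_{a,r}+\mathrm{Lap}(2B_\tau/\epsilon)$, with independent noises. - Set $\bar\mu_a=\frac1{R_\tau}\sum_{r=1}^{R_\tau}\widehat x_{a,r}$ and $err_\tau=u^{1/(1+v)}\left(\frac{\sqrt{L_\tau}}{\sqrt{R_\tau}\,\epsilon}\right)^{v/(1+v)}$. Remove from $\mathcal S$ every arm $a$ with $\max_{a'\in\mathcal S}\bar\mu_{a'}-\bar\mu_a>14\,err_\tau$. Once $|\mathcal S|=1$, pull the remaining arm in all remaining rounds. *)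

theory Defs
  imports "HOL-Probability.Probability"
begin

section \<open>Local differential privacy\<close>

text \<open>A randomized map from \<open>X\<close> to \<open>Y\<close> is a Markov kernel: \<open>M x\<close> is the law of the output on
  input \<open>x\<close>.\<close>

definition LDP_map :: "real \<Rightarrow> 'x measure \<Rightarrow> 'y measure \<Rightarrow> ('x \<Rightarrow> 'y measure) \<Rightarrow> bool" where
  "LDP_map \<epsilon> X Y M \<longleftrightarrow>
     M \<in> X \<rightarrow>\<^sub>M prob_algebra Y \<and>
     (\<forall>x\<in>space X. \<forall>x'\<in>space X. \<forall>A\<in>sets Y. measure (M x) A \<le> exp \<epsilon> * measure (M x') A)"

text \<open>A round is a triple (arm pulled, reward generated, value collected); a history lists the past
  rounds chronologically. For a given history, \<open>pull\<close> is the law of the next arm (its randomness is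
  the learner's internal randomness) and \<open>collect\<close> sends the pulled arm and its generated reward to
  the law of the value collected. A general algorithm may let both depend on the raw past rewards;
  it is part of being locally private that they do not. The environment is left arbitrary, so
  histories range over all possible rewards.\<close>

type_synonym bandit_round = "nat \<times> real \<times> real"

record bandit_algorithm =
  horizon :: nat
  pull :: "bandit_round list \<Rightarrow> nat pmf"
  collect :: "bandit_round list \<Rightarrow> nat \<Rightarrow> real \<Rightarrow> real measure"

definition collected :: "bandit_round list \<Rightarrow> (nat \<times> real) list" where
  "collected h = map (\<lambda>(a, x, y). (a, y)) h"

definition LDP_bandit :: "real \<Rightarrow> bandit_algorithm \<Rightarrow> bool" where
  "LDP_bandit \<epsilon> A \<longleftrightarrow>
     (\<forall>h a. length h < horizon A \<longrightarrow> LDP_map \<epsilon> borel borel (collect A h a)) \<and>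
     (\<forall>h h'. length h < horizon A \<longrightarrow> collected h = collected h' \<longrightarrow>
        pull A h = pull A h' \<and> collect A h = collect A h')"


section \<open>LDP Robust Successive Elimination\<close>

definition Lap :: "real \<Rightarrow> real measure" where
  "Lap l = density lborel (\<lambda>x. ennreal (1 / (2 * l) * exp (- \<bar>x\<bar> / l)))"

definition trunc_reward :: "real \<Rightarrow> real \<Rightarrow> real" where
  "trunc_reward B x = (if \<bar>x\<bar> \<le> B then x else 0)"

text \<open>Below, \<open>n\<close> is the number of viable arms in epoch \<open>\<tau>\<close>.\<close>

definition L_ep :: "real \<Rightarrow> nat \<Rightarrow> nat \<Rightarrow> real" where
  "L_ep \<beta> n \<tau> = ln (8 * real n * (real \<tau>)\<^sup>2 / \<beta>)"

definition D_ep :: "nat \<Rightarrow> real" where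
  "D_ep \<tau> = 4 powr (- real \<tau>)"

definition R_ep :: "real \<Rightarrow> real \<Rightarrow> real \<Rightarrow> real \<Rightarrow> nat \<Rightarrow> nat \<Rightarrow> nat" where
  "R_ep \<beta> \<epsilon> v u n \<tau> =
     nat \<lceil>u powr (2 / v) *
            (28 powr (2 * (1 + v) / v) * L_ep \<beta> n \<tau> / (\<epsilon>\<^sup>2 * D_ep \<tau> powr (2 * (1 + v) / v)))
          + L_ep \<beta> n \<tau>\<rceil>"

definition B_ep :: "real \<Rightarrow> real \<Rightarrow> real \<Rightarrow> real \<Rightarrow> nat \<Rightarrow> nat \<Rightarrow> real" where
  "B_ep \<beta> \<epsilon> v u n \<tau> =
     (u * sqrt (real (R_ep \<beta> \<epsilon> v u n \<tau>)) * \<epsilon> / sqrt (L_ep \<beta> n \<tau>)) powr (1 / (1 + v))"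

definition err_ep :: "real \<Rightarrow> real \<Rightarrow> real \<Rightarrow> real \<Rightarrow> nat \<Rightarrow> nat \<Rightarrow> real" where
  "err_ep \<beta> \<epsilon> v u n \<tau> =
     u powr (1 / (1 + v)) *
     (sqrt (L_ep \<beta> n \<tau>) / (sqrt (real (R_ep \<beta> \<epsilon> v u n \<tau>)) * \<epsilon>)) powr (v / (1 + v))"

text \<open>The learner's state: the viable set, the index of the current epoch and the pairs
  (arm, value collected) of the current epoch so far.\<close>

record rse_state =
  viable :: "nat set"
  epoch :: nat
  obs :: "(nat \<times> real) list"

definition rse_init :: "nat \<Rightarrow> rse_state" where
  "rse_init K = \<lparr>viable = {1..K}, epoch = 1, obs = []\<rparr>"

definition emp_mean :: "nat \<Rightarrow> (nat \<times> real) list \<Rightarrow> nat \<Rightarrow> real" where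
  "emp_mean R ys a = (\<Sum>(b, y)\<leftarrow>ys. if b = a then y else 0) / real R"

definition eliminate ::
    "real \<Rightarrow> real \<Rightarrow> real \<Rightarrow> real \<Rightarrow> nat set \<Rightarrow> nat \<Rightarrow> (nat \<times> real) list \<Rightarrow> nat set" where
  "eliminate \<beta> \<epsilon> v u S \<tau> ys =
     (let m = emp_mean (R_ep \<beta> \<epsilon> v u (card S) \<tau>) ys
      in S - {a \<in> S. Max (m ` S) - m a > 14 * err_ep \<beta> \<epsilon> v u (card S) \<tau>})"

definition rse_step ::
    "real \<Rightarrow> real \<Rightarrow> real \<Rightarrow> real \<Rightarrow> nat \<times> real \<Rightarrow> rse_state \<Rightarrow> rse_state" where
  "rse_step \<beta> \<epsilon> v u ay s =
     (let S = viable s; \<tau> = epoch s; ys = obs s @ [ay] in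
      if card S = 1 then s
      else if length ys < card S * R_ep \<beta> \<epsilon> v u (card S) \<tau> then s\<lparr>obs := ys\<rparr>
      else \<lparr>viable = eliminate \<beta> \<epsilon> v u S \<tau> ys, epoch = \<tau> + 1, obs = []\<rparr>)"

definition rse_state_after ::
    "real \<Rightarrow> real \<Rightarrow> real \<Rightarrow> real \<Rightarrow> nat \<Rightarrow> (nat \<times> real) list \<Rightarrow> rse_state" where
  "rse_state_after \<beta> \<epsilon> v u K ys = fold (rse_step \<beta> \<epsilon> v u) ys (rse_init K)"

definition rse_arm :: "rse_state \<Rightarrow> nat" where
  "rse_arm s = sorted_list_of_set (viable s) ! (length (obs s) mod card (viable s))"

text \<open>Once a single arm is left, its rewards are not collected: the value recorded is the constant 0
  (and \<^const>\<open>rse_step\<close> ignores it).\<close>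

definition rse_release :: "real \<Rightarrow> real \<Rightarrow> real \<Rightarrow> real \<Rightarrow> rse_state \<Rightarrow> real \<Rightarrow> real measure" where
  "rse_release \<beta> \<epsilon> v u s x =
     (if card (viable s) = 1 then return borel 0
      else let B = B_ep \<beta> \<epsilon> v u (card (viable s)) (epoch s)
           in distr (Lap (2 * B / \<epsilon>)) borel (\<lambda>z. trunc_reward B x + z))"

definition LDP_RSE :: "nat \<Rightarrow> nat \<Rightarrow> real \<Rightarrow> real \<Rightarrow> real \<Rightarrow> real \<Rightarrow> bandit_algorithm" where
  "LDP_RSE K T \<beta> \<epsilon> v u =
     \<lparr>horizon = T,
      pull = (\<lambda>h. return_pmf (rse_arm (rse_state_after \<beta> \<epsilon> v u K (collected h)))),
      collect = (\<lambda>h a. rse_release \<beta> \<epsilon> v u (rse_state_after \<beta> \<epsilon> v u K (collected h)))\<rparr>"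

end

theory Submission
  imports Defs
begin

text \<open>The generated reward enters the collected value only through its truncation to \<open>[-B, B]\<close>.
  Two truncated rewards differ by at most \<open>2 * B\<close>, so shifting the density of \<open>Lap (2 * B / \<epsilon>)\<close> by
  either of them changes it by a factor of at most \<open>exp \<epsilon>\<close>. This needs \<open>B > 0\<close>, hence a nonempty
  viable set and \<open>\<tau> \<ge> 1\<close>, which the run preserves because an arm with the largest empirical mean is
  never eliminated.\<close>

lemma sets_Lap [measurable_cong, simp]: "sets (Lap l) = sets borel"
  and space_Lap [simp]: "space (Lap l) = UNIV"
  by (simp_all add: Lap_def)

text \<open>The Laplace density is the average of the exponential density of rate
  \<open>1 / l\<close> and its reflection at 0, each of total mass 1.\<close>

lemma prob_space_Lap:
  assumes "l > 0"
  shows "prob_space (Lap l)"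
proof -
  let ?e = "exponential_density (1 / l)"
  have e: "(\<integral>\<^sup>+x. ennreal (?e x) \<partial>lborel) = 1"
    using prob_space.emeasure_space_1[OF prob_space_exponential_density[of "1 / l"]] assms
    by (simp add: emeasure_density)
  have "(\<integral>\<^sup>+x. ennreal (?e (- x)) \<partial>lborel) = (\<integral>\<^sup>+x. ennreal (?e x) \<partial>lborel)"
    using nn_integral_real_affine[of "\<lambda>x. ennreal (?e x)" "-1" 0] by simp
  with e have e': "(\<integral>\<^sup>+x. ennreal (?e (- x)) \<partial>lborel) = 1" by simp
  define c :: real where "c = 1 / 2"
  have c: "c \<ge> 0" "\<And>y. c * y / l = y / (2 * l)" "c + c = 1" by (simp_all add: c_def)
  have "(\<integral>\<^sup>+x. ennreal (1 / (2 * l) * exp (- \<bar>x\<bar> / l)) \<partial>lborel) =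
        (\<integral>\<^sup>+x. ennreal c * ennreal (?e x) + ennreal c * ennreal (?e (- x)) \<partial>lborel)"
  proof (rule nn_integral_cong_AE)
    show "AE x in lborel. ennreal (1 / (2 * l) * exp (- \<bar>x\<bar> / l)) =
        ennreal c * ennreal (?e x) + ennreal c * ennreal (?e (- x))"
      \<comment> \<open>At 0 both exponential densities are nonzero and the average is twice the
        Laplace density, so the identity holds only off this null set.\<close>
      using AE_lborel_singleton[of "0::real"]
      by eventually_elim
        (use assms c in \<open>auto simp: exponential_density_def simp flip: ennreal_mult'\<close>)
  qed
  also have "\<dots> = ennreal c + ennreal c"
    by (simp add: nn_integral_add nn_integral_cmult e e')
  also have "\<dots> = 1"
    using c by (simp flip: ennreal_plus)
  finally show ?thesis
    by (intro prob_spaceI) (simp add: Lap_def emeasure_density)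
qed

text \<open>The substitution \<open>y = t + z\<close> moves the shift from the set into the density,
  so that two shifts can be compared pointwise on the same \<open>A\<close>.\<close>

lemma emeasure_Lap_shift:
  assumes [measurable]: "A \<in> sets borel"
  shows "emeasure (distr (Lap l) borel ((+) t)) A =
    (\<integral>\<^sup>+y. ennreal (1 / (2 * l) * exp (- \<bar>y - t\<bar> / l)) * indicator A y \<partial>lborel)"
proof -
  let ?d = "\<lambda>x. ennreal (1 / (2 * l) * exp (- \<bar>x\<bar> / l))"
  have "emeasure (distr (Lap l) borel ((+) t)) A = emeasure (Lap l) ((+) t -` A)"
    by (subst emeasure_distr) auto
  also have "\<dots> = (\<integral>\<^sup>+z. ?d z * indicator ((+) t -` A) z \<partial>lborel)"
    unfolding Lap_def
    by (rule emeasure_density) (use measurable_sets_borel[of "(+) t" borel A] in auto)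
  also have "\<dots> = (\<integral>\<^sup>+z. ?d (t + 1 * z - t) * indicator A (t + 1 * z) \<partial>lborel)"
    by (intro nn_integral_cong) (simp add: indicator_def)
  also have "\<dots> = (\<integral>\<^sup>+y. ?d (y - t) * indicator A y \<partial>lborel)"
    by (subst nn_integral_real_affine[of _ 1 t]) auto
  finally show ?thesis .
qed

text \<open>The Laplace mechanism for a query of sensitivity at most \<open>\<Delta>\<close>: a
  pointwise bound on the ratio of the two shifted densities integrates to the bound on
  measures.\<close>

lemma LDP_map_Laplace:
  fixes f :: "'x \<Rightarrow> real"
  assumes f [measurable]: "f \<in> borel_measurable X"
    and sens: "\<And>x x'. x \<in> space X \<Longrightarrow> x' \<in> space X \<Longrightarrow> \<bar>f x - f x'\<bar> \<le> \<Delta>"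
    and "\<Delta> > 0" "\<epsilon> > 0"
  shows "LDP_map \<epsilon> X borel (\<lambda>x. distr (Lap (\<Delta> / \<epsilon>)) borel ((+) (f x)))"
proof -
  define l where "l = \<Delta> / \<epsilon>"
  have l: "l > 0" "\<Delta> = \<epsilon> * l" using assms by (auto simp: l_def)
  interpret Lap: prob_space "Lap l" by (rule prob_space_Lap) fact
  have ps: "prob_space (distr (Lap l) borel ((+) t))" for t
    by (rule Lap.prob_space_distr) simp
  have "Lap l \<in> space (prob_algebra borel)"
    by (simp add: space_prob_algebra Lap.prob_space_axioms)
  \<comment> \<open>Kernel measurability: a constant kernel is pushed forward along the jointly
    measurable map sending \<open>(x, z)\<close> to \<open>f x + z\<close>.\<close>
  then have "(\<lambda>x. distr (Lap l) borel ((+) (f x))) \<in> X \<rightarrow>\<^sub>M prob_algebra borel"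
    by (intro measurable_distr_prob_space2[where M = borel] measurable_const) measurable
  moreover have "measure (distr (Lap l) borel ((+) (f x))) A
      \<le> exp \<epsilon> * measure (distr (Lap l) borel ((+) (f x'))) A"
    if x: "x \<in> space X" "x' \<in> space X" and A [measurable]: "A \<in> sets borel" for x x' A
  proof -
    interpret P: prob_space "distr (Lap l) borel ((+) (f x))" by (rule ps)
    interpret Q: prob_space "distr (Lap l) borel ((+) (f x'))" by (rule ps)
    have "1 / (2 * l) * exp (- \<bar>y - f x\<bar> / l)
        \<le> exp \<epsilon> * (1 / (2 * l) * exp (- \<bar>y - f x'\<bar> / l))" for y
    proof -
      \<comment> \<open>Triangle inequality with \<open>\<Delta> = \<epsilon> * l\<close>; dividing
        by the scale \<open>l\<close> leaves exactly \<open>\<epsilon>\<close> in the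
        exponent.\<close>
      have "\<bar>y - f x'\<bar> \<le> \<epsilon> * l + \<bar>y - f x\<bar>" using sens[OF x] l by linarith
      then have "- \<bar>y - f x\<bar> / l \<le> \<epsilon> + - \<bar>y - f x'\<bar> / l"
        using l by (simp add: field_simps)
      then have "exp (- \<bar>y - f x\<bar> / l) \<le> exp \<epsilon> * exp (- \<bar>y - f x'\<bar> / l)"
        by (simp flip: exp_add)
      then show ?thesis using l by (simp add: divide_right_mono)
    qed
    then have "emeasure (distr (Lap l) borel ((+) (f x))) A \<le>
        (\<integral>\<^sup>+y. ennreal (exp \<epsilon>) *
          (ennreal (1 / (2 * l) * exp (- \<bar>y - f x'\<bar> / l)) * indicator A y) \<partial>lborel)"
      unfolding emeasure_Lap_shift[OF A]
      by (intro nn_integral_mono)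
        (auto simp: indicator_def simp flip: ennreal_mult' intro!: ennreal_leI)
    also have "\<dots> = ennreal (exp \<epsilon>) * emeasure (distr (Lap l) borel ((+) (f x'))) A"
      unfolding emeasure_Lap_shift[OF A] by (rule nn_integral_cmult) measurable
    finally show ?thesis
      by (simp add: P.emeasure_eq_measure Q.emeasure_eq_measure flip: ennreal_mult')
  qed
  ultimately show ?thesis
    by (simp add: LDP_map_def flip: l_def)
qed

text \<open>An output that ignores the input leaks nothing, so only
  \<open>1 \<le> exp \<epsilon>\<close> is at stake. This covers the rounds after a single arm is
  left.\<close>

lemma LDP_map_return:
  assumes "\<epsilon> \<ge> 0" "c \<in> space Y"
  shows "LDP_map \<epsilon> X Y (\<lambda>_. return Y c)"
  unfolding LDP_map_def
proof (intro conjI ballI)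
  show "(\<lambda>_. return Y c) \<in> X \<rightarrow>\<^sub>M prob_algebra Y"
    using assms by (intro measurable_const) (simp add: space_prob_algebra prob_space_return)
next
  fix A
  have "1 * measure (return Y c) A \<le> exp \<epsilon> * measure (return Y c) A"
    using assms by (intro mult_right_mono) auto
  then show "measure (return Y c) A \<le> exp \<epsilon> * measure (return Y c) A" by simp
qed

lemma L_ep_pos:
  assumes "0 < \<beta>" "\<beta> < 1" "n \<ge> 1" "\<tau> \<ge> 1"
  shows "L_ep \<beta> n \<tau> > 0"
proof -
  have "1 \<le> real n * (real \<tau>)\<^sup>2"
    using mult_mono[of 1 "real n" 1 "(real \<tau>)\<^sup>2"] assms by simp
  then have "\<beta> < 8 * real n * (real \<tau>)\<^sup>2" using assms by linarith
  then show ?thesis using assms unfolding L_ep_def by (intro ln_gt_zero) simp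
qed

lemma B_ep_pos:
  assumes "0 < \<beta>" "\<beta> < 1" "u > 0" "\<epsilon> > 0" "n \<ge> 1" "\<tau> \<ge> 1"
  shows "B_ep \<beta> \<epsilon> v u n \<tau> > 0"
proof -
  have L: "L_ep \<beta> n \<tau> > 0" by (rule L_ep_pos) fact+
  then have "u powr (2 / v) *
            (28 powr (2 * (1 + v) / v) * L_ep \<beta> n \<tau> / (\<epsilon>\<^sup>2 * D_ep \<tau> powr (2 * (1 + v) / v)))
          + L_ep \<beta> n \<tau> > 0"
    \<comment> \<open>The first summand is nonnegative; strictness comes from \<open>L_ep\<close>.
      The ceiling of a positive real is at least 1, hence \<open>R_ep\<close> is positive.\<close>
    by (intro add_nonneg_pos) auto
  then have "R_ep \<beta> \<epsilon> v u n \<tau> > 0" by (simp add: R_ep_def)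
  then show ?thesis using assms L by (simp add: B_ep_def)
qed

lemma eliminate_nonempty:
  assumes "finite S" "S \<noteq> {}"
  shows "eliminate \<beta> \<epsilon> v u S \<tau> ys \<noteq> {}"
proof -
  define m where "m = emp_mean (R_ep \<beta> \<epsilon> v u (card S) \<tau>) ys"
  have "Max (m ` S) \<in> m ` S" using assms by (intro Max_in) auto
  then obtain a where "a \<in> S" "Max (m ` S) = m a" by auto
  \<comment> \<open>The maximizer has gap 0, which cannot exceed a nonnegative threshold.\<close>
  moreover have "err_ep \<beta> \<epsilon> v u (card S) \<tau> \<ge> 0" by (simp add: err_ep_def)
  ultimately have "a \<in> eliminate \<beta> \<epsilon> v u S \<tau> ys"
    unfolding eliminate_def Let_def m_def[symmetric] by simp
  then show ?thesis by blast
qed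

text \<open>Invariant of the run: finiteness and nonemptiness give a cardinality of at least 1, as
  \<open>B_ep_pos\<close> requires along with the bound on the epoch.\<close>

definition rse_valid :: "rse_state \<Rightarrow> bool" where
  "rse_valid s \<longleftrightarrow> finite (viable s) \<and> viable s \<noteq> {} \<and> epoch s \<ge> 1"

lemma rse_valid_step:
  assumes "rse_valid s"
  shows "rse_valid (rse_step \<beta> \<epsilon> v u ay s)"
proof -
  have "finite (eliminate \<beta> \<epsilon> v u (viable s) \<tau> ys)" for \<tau> ys
    using assms by (simp add: rse_valid_def eliminate_def Let_def)
  with assms show ?thesis
    by (simp add: rse_valid_def rse_step_def Let_def eliminate_nonempty)
qed

text \<open>Stated for arbitrary \<open>ys\<close>, because \<open>LDP_bandit\<close> ranges over
  all histories, including those that no run produces.\<close>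

lemma rse_valid_state_after:
  assumes "K \<ge> 1"
  shows "rse_valid (rse_state_after \<beta> \<epsilon> v u K ys)"
proof -
  have "rse_valid (fold (rse_step \<beta> \<epsilon> v u) ys s)" if "rse_valid s" for s
    using that by (induction ys arbitrary: s) (simp_all add: rse_valid_step)
  moreover have "rse_valid (rse_init K)"
    using assms by (simp add: rse_valid_def rse_init_def)
  ultimately show ?thesis by (simp add: rse_state_after_def)
qed

lemma LDP_map_rse_release:
  assumes "0 < \<beta>" "\<beta> < 1" "u > 0" "\<epsilon> > 0" "rse_valid s"
  shows "LDP_map \<epsilon> borel borel (rse_release \<beta> \<epsilon> v u s)"
proof (cases "card (viable s) = 1")
  case True
  then have "rse_release \<beta> \<epsilon> v u s = (\<lambda>_. return borel 0)"
    by (simp add: rse_release_def fun_eq_iff)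
  then show ?thesis using assms by (simp add: LDP_map_return)
next
  case False
  define B where "B = B_ep \<beta> \<epsilon> v u (card (viable s)) (epoch s)"
  have B: "B > 0"
    unfolding B_def using assms by (intro B_ep_pos) (auto simp: rse_valid_def Suc_le_eq card_gt_0_iff)
  have [measurable]: "trunc_reward B \<in> borel_measurable borel"
    unfolding trunc_reward_def by measurable
  have "LDP_map \<epsilon> borel borel (\<lambda>x. distr (Lap (2 * B / \<epsilon>)) borel ((+) (trunc_reward B x)))"
    using assms B by (intro LDP_map_Laplace) (auto simp: trunc_reward_def)
  moreover have "rse_release \<beta> \<epsilon> v u s =
      (\<lambda>x. distr (Lap (2 * B / \<epsilon>)) borel ((+) (trunc_reward B x)))"
    using False by (simp add: rse_release_def Let_def B_def fun_eq_iff)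
  ultimately show ?thesis by simp
qed

theorem theorem6:
  fixes K T :: nat and v u \<beta> \<epsilon> :: real
  assumes "K \<ge> 2" and "T \<ge> 1"
    and "0 < v" and "v \<le> 1"
    and "u > 0"
    and "0 < \<beta>" and "\<beta> < 1"
    and "\<epsilon> > 0"
  shows "LDP_bandit \<epsilon> (LDP_RSE K T \<beta> \<epsilon> v u)"
  \<comment> \<open>\<open>pull\<close> and \<open>collect\<close> see the history only through
    \<open>collected h\<close>, so equal collected data give equal decisions at once; what remains
    is privacy of the release in a valid state.\<close>
  using assms
  by (auto simp: LDP_bandit_def LDP_RSE_def intro!: LDP_map_rse_release rse_valid_state_after)

end
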